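(* A triangle in the plane has a taxicab Apollonius circle if it is transformationally equivalent to a triangle $\triangle ABC$ of one of the following types, where $m_a, m_b, m_c$ denote the slopes of the sides $\overline{BC}, \overline{AC}, \overline{AB}$ (opposite $\angle A,\angle B,\angle C$) respectively: (1) $\triangle ABC$ is minimally inscribed, its completely inscribed angle is $\angle C$, which is formed by the sides of shallow slopes $0<m_a<1$ and $-1<m_b<m_a$, and either (a) $1<|m_c|<\infty$ and at least one of the inequalities $$\frac{m_b}{m_c}+2m_a-m_b-1\ \ge\ \frac{1}{m_c}\qquad\text{or}\qquad 1-m_a+2m_b-\frac{m_a}{m_c}\ \le\ \frac{1}{m_c}$$ holds, or (b) $\overline{AB}$ is vertical and $2m_a-m_b\ge 1$; (2) $\triangle ABC$ has exactly two completely inscribed angles, and of its non-diagonal sides one is shallow and the other is steep.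
   Context: All triangles are non-degenerate and lie in $\mathbb{R}^2$ with the taxicab distance $d((x_1,y_1),(x_2,y_2))=|x_1-x_2|+|y_1-y_2|$. A taxicab circle of center $P$ and radius $r>0$ is $\{Q: d(P,Q)=r\}$ (a square with sides of slope $\pm1$); its closed disk is $\{Q:d(P,Q)\le r\}$. A line, segment or side is diagonal if its slope is $\pm1$, shallow if its slope has absolute value $<1$, and steep if it is vertical or its slope has absolute value $>1$. Inscribed angles: an angle (of a triangle) with vertex $V$ is positively inscribed if the line of slope $+1$ through $V$ does not meet the interior of the angle, and negatively inscribed if the line of slope $-1$ through $V$ does not meet the interior of the angle. It is completely inscribed if it is both positively and negatively inscribed, and inscribed if it is at least one of the two. A triangle is an inscribed triangle if all of its angles are inscribed. A triangle is minimally inscribed if it has only one (exactly one) completely inscribed angle. Excircles: an excircle of a triangle at a side is a taxicab circle outside the triangle that is tangent to that side and tangent to both rays forming the angle of the triangle opposite that side. Precisely, for the side $\overline{AB}$ of $\triangle ABC$: its closed disk lies in the closed angular region $\angle ACB$ and in the closed half-plane bounded by line $AB$ not containing $C$, and the circle has at least one point in common with the segment $\overline{AB}$, with the ray from $C$ through $A$, and with the ray from $C$ through $B$ (contact may be at a corner of the circle, along a segment, or at a vertex of the triangle). Apollonius circle: a triangle has a taxicab Apollonius circle if it has an excircle at each of its three sides and there is a taxicab circle tangentially encompassing these three excircles, i.e. a taxicab circle whose closed disk contains the three excircles and which has at least one point in common with each of them. Two triangles are transformationally equivalent if one is carried onto the other (up to relabeling vertices) by a composition of translations and reflections in the lines $y=x$,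 $y=-x$, $x=0$, $y=0$. *)

theory Defs
  imports "HOL-Analysis.Analysis"
begin

type_synonym point = "real \<times> real"

definition triangle :: "point \<Rightarrow> point \<Rightarrow> point \<Rightarrow> bool" where
  "triangle A B C \<longleftrightarrow> \<not> collinear {A, B, C}"

definition taxi_dist :: "point \<Rightarrow> point \<Rightarrow> real" where
  "taxi_dist P Q = \<bar>fst P - fst Q\<bar> + \<bar>snd P - snd Q\<bar>"

definition taxi_circle :: "point \<Rightarrow> real \<Rightarrow> point set" where
  "taxi_circle P r = {Q. taxi_dist P Q = r}"

definition taxi_disk :: "point \<Rightarrow> real \<Rightarrow> point set" where
  "taxi_disk P r = {Q. taxi_dist P Q \<le> r}"

definition vertical :: "point \<Rightarrow> point \<Rightarrow> bool" where
  "vertical P Q \<longleftrightarrow> fst P = fst Q"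

(* Only meaningful when the line is not vertical; every use is guarded accordingly,
   since division by zero yields 0. *)
definition slope :: "point \<Rightarrow> point \<Rightarrow> real" where
  "slope P Q = (snd Q - snd P) / (fst Q - fst P)"

definition diagonal :: "point \<Rightarrow> point \<Rightarrow> bool" where
  "diagonal P Q \<longleftrightarrow> \<not> vertical P Q \<and> \<bar>slope P Q\<bar> = 1"

definition shallow :: "point \<Rightarrow> point \<Rightarrow> bool" where
  "shallow P Q \<longleftrightarrow> \<not> vertical P Q \<and> \<bar>slope P Q\<bar> < 1"

definition steep :: "point \<Rightarrow> point \<Rightarrow> bool" where
  "steep P Q \<longleftrightarrow> vertical P Q \<or> \<bar>slope P Q\<bar> > 1"

(* In the next group, the first argument V is the vertex of the angle and P, Q are
   points other than V on its two rays. *)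

definition ray :: "point \<Rightarrow> point \<Rightarrow> point set" where
  "ray V P = {V + s *\<^sub>R (P - V) |s. s \<ge> 0}"

definition angle_region :: "point \<Rightarrow> point \<Rightarrow> point \<Rightarrow> point set" where
  "angle_region V P Q = {V + s *\<^sub>R (P - V) + t *\<^sub>R (Q - V) |s t. s \<ge> 0 \<and> t \<ge> 0}"

definition angle_interior :: "point \<Rightarrow> point \<Rightarrow> point \<Rightarrow> point set" where
  "angle_interior V P Q = {V + s *\<^sub>R (P - V) + t *\<^sub>R (Q - V) |s t. s > 0 \<and> t > 0}"

definition positively_inscribed :: "point \<Rightarrow> point \<Rightarrow> point \<Rightarrow> bool" where
  "positively_inscribed V P Q \<longleftrightarrow>
     {V + t *\<^sub>R (1, 1) |t. True} \<inter> angle_interior V P Q = {}"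

definition negatively_inscribed :: "point \<Rightarrow> point \<Rightarrow> point \<Rightarrow> bool" where
  "negatively_inscribed V P Q \<longleftrightarrow>
     {V + t *\<^sub>R (1, -1) |t. True} \<inter> angle_interior V P Q = {}"

definition completely_inscribed :: "point \<Rightarrow> point \<Rightarrow> point \<Rightarrow> bool" where
  "completely_inscribed V P Q \<longleftrightarrow> positively_inscribed V P Q \<and> negatively_inscribed V P Q"

definition angles :: "point \<Rightarrow> point \<Rightarrow> point \<Rightarrow> (point \<times> point \<times> point) set" where
  "angles A B C = {(A, B, C), (B, C, A), (C, A, B)}"

definition num_completely_inscribed :: "point \<Rightarrow> point \<Rightarrow> point \<Rightarrow> nat" where
  "num_completely_inscribed A B C =
     card {(V, P, Q) \<in> angles A B C. completely_inscribed V P Q}"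

definition minimally_inscribed :: "point \<Rightarrow> point \<Rightarrow> point \<Rightarrow> bool" where
  "minimally_inscribed A B C \<longleftrightarrow> num_completely_inscribed A B C = 1"

definition sides :: "point \<Rightarrow> point \<Rightarrow> point \<Rightarrow> (point \<times> point) set" where
  "sides A B C = {(B, C), (C, A), (A, B)}"

definition nondiagonal_sides_shallow_and_steep :: "point \<Rightarrow> point \<Rightarrow> point \<Rightarrow> bool" where
  "nondiagonal_sides_shallow_and_steep A B C \<longleftrightarrow>
     (\<exists>P Q R S. {(X, Y) \<in> sides A B C. \<not> diagonal X Y} = {(P, Q), (R, S)} \<and>
        shallow P Q \<and> steep R S)"

(* The sign of cross A B Q tells on which side of the line AB the point Q lies. *)
definition cross :: "point \<Rightarrow> point \<Rightarrow> point \<Rightarrow> real" where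
  "cross A B Q = (fst B - fst A) * (snd Q - snd A) - (snd B - snd A) * (fst Q - fst A)"

definition opposite_half_plane :: "point \<Rightarrow> point \<Rightarrow> point \<Rightarrow> point set" where
  "opposite_half_plane C A B = {Q. cross A B Q * cross A B C \<le> 0}"

(* The circle with centre X and radius r is an excircle at the side AB, opposite C. *)
definition is_excircle :: "point \<Rightarrow> point \<Rightarrow> point \<Rightarrow> point \<Rightarrow> real \<Rightarrow> bool" where
  "is_excircle C A B X r \<longleftrightarrow> r > 0 \<and>
     taxi_disk X r \<subseteq> angle_region C A B \<and>
     taxi_disk X r \<subseteq> opposite_half_plane C A B \<and>
     taxi_circle X r \<inter> closed_segment A B \<noteq> {} \<and>
     taxi_circle X r \<inter> ray C A \<noteq> {} \<and>
     taxi_circle X r \<inter> ray C B \<noteq> {}"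

definition encompasses_tangentially :: "point \<Rightarrow> real \<Rightarrow> point \<Rightarrow> real \<Rightarrow> bool" where
  "encompasses_tangentially Z R X r \<longleftrightarrow>
     taxi_circle X r \<subseteq> taxi_disk Z R \<and> taxi_circle Z R \<inter> taxi_circle X r \<noteq> {}"

definition has_taxicab_apollonius_circle :: "point \<Rightarrow> point \<Rightarrow> point \<Rightarrow> bool" where
  "has_taxicab_apollonius_circle A B C \<longleftrightarrow>
     (\<exists>X\<^sub>a r\<^sub>a X\<^sub>b r\<^sub>b X\<^sub>c r\<^sub>c.
        is_excircle A B C X\<^sub>a r\<^sub>a \<and> is_excircle B C A X\<^sub>b r\<^sub>b \<and> is_excircle C A B X\<^sub>c r\<^sub>c \<and>
        (\<exists>Z R. R > 0 \<and>
           encompasses_tangentially Z R X\<^sub>a r\<^sub>a \<and>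
           encompasses_tangentially Z R X\<^sub>b r\<^sub>b \<and>
           encompasses_tangentially Z R X\<^sub>c r\<^sub>c))"

inductive taxi_transformation :: "(point \<Rightarrow> point) \<Rightarrow> bool" where
  translation: "taxi_transformation (\<lambda>P. P + v)"
| reflect_main_diagonal: "taxi_transformation (\<lambda>(x, y). (y, x))"
| reflect_anti_diagonal: "taxi_transformation (\<lambda>(x, y). (- y, - x))"
| reflect_y_axis: "taxi_transformation (\<lambda>(x, y). (- x, y))"
| reflect_x_axis: "taxi_transformation (\<lambda>(x, y). (x, - y))"
| composition: "taxi_transformation f \<Longrightarrow> taxi_transformation g \<Longrightarrow> taxi_transformation (f \<circ> g)"

(* Comparing vertex sets, rather than triples, accounts for relabelling the vertices. *)
definition transformationally_equivalent ::
    "point \<Rightarrow> point \<Rightarrow> point \<Rightarrow> point \<Rightarrow> point \<Rightarrow> point \<Rightarrow> bool" where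
  "transformationally_equivalent P Q R A B C \<longleftrightarrow>
     (\<exists>f. taxi_transformation f \<and> f ` {P, Q, R} = {A, B, C})"

end

theory Submission
  imports Defs
begin

text \<open>
  Put \<open>C\<close> at the origin, with \<open>A\<close> and \<open>B\<close> to the right of it on lines of slopes
  \<open>b < a\<close> and the line \<open>AB\<close> given by \<open>x = T + k y\<close>, where \<open>k\<close> is the inverse slope. The excircles
  at \<open>BC\<close> and \<open>AC\<close> touch both sides at \<open>C\<close>: their centres are \<open>(0, \<rho>)\<close> and \<open>(0, -\<sigma>)\<close> with radii
  \<open>\<rho> = T / (1 - k)\<close> and \<open>\<sigma> = T / (1 + k)\<close>. The excircle at \<open>AB\<close> touches the other two sides at its
  top and bottom corners \<open>(L, a L)\<close> and \<open>(L, b L)\<close> and the side \<open>AB\<close> at its left corner.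
  A circle of radius \<open>R\<close> and centre \<open>Z\<close> tangentially encompasses one of radius \<open>r\<close> and centre \<open>X\<close>
  as soon as \<open>d(Z, X) + r = R\<close>. Every \<open>Z = (R - \<rho> - \<sigma>, \<rho> - \<sigma>)\<close> with \<open>R \<ge> \<rho> + \<sigma>\<close> achieves this for the
  first two excircles, and the third one forces \<open>R = max (L (1 + a) / 2 + \<sigma>) (L (1 - b) / 2 + \<rho>)\<close>.
  The inequality \<open>R \<ge> \<rho> + \<sigma>\<close> is the disjunction in type (1). Type (2) is the
  limiting case \<open>a = 1\<close>, where the first disjunct reads \<open>0 \<le> (1 - b) (1 - k)\<close> and always holds.
\<close>

subsection \<open>Invariance\<close>

lemma angle_region_commute: "angle_region V P Q = angle_region V Q P"
  unfolding angle_region_def by (auto simp: algebra_simps) (metis add.commute add.left_commute)+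

lemma opposite_half_plane_commute: "opposite_half_plane C A B = opposite_half_plane C B A"
proof -
  have "cross A B Q = - cross B A Q" for Q
    by (simp add: cross_def algebra_simps)
  then show ?thesis by (simp add: opposite_half_plane_def)
qed

lemma is_excircle_commute: "is_excircle C A B X r \<longleftrightarrow> is_excircle C B A X r"
  unfolding is_excircle_def
  by (metis angle_region_commute opposite_half_plane_commute closed_segment_commute)

lemma apollonius_rotate:
  "has_taxicab_apollonius_circle A B C \<Longrightarrow> has_taxicab_apollonius_circle B C A"
  unfolding has_taxicab_apollonius_circle_def by blast

lemma apollonius_swap:
  "has_taxicab_apollonius_circle A B C \<Longrightarrow> has_taxicab_apollonius_circle B A C"
  unfolding has_taxicab_apollonius_circle_def using is_excircle_commute by metis

text \<open>Non-degeneracy makes the vertices distinct, so equal vertex sets differ by one of six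
  permutations, and these are generated by a rotation and a swap.\<close>

lemma apollonius_permute:
  assumes "has_taxicab_apollonius_circle A B C" "triangle A B C" "{P, Q, R} = {A, B, C}"
  shows "has_taxicab_apollonius_circle P Q R"
proof -
  have "A \<noteq> B" "A \<noteq> C" "B \<noteq> C"
    using assms(2) by (auto simp: triangle_def insert_commute)
  then have "card {P, Q, R} = 3" unfolding assms(3) by simp
  then have "P \<noteq> Q" "P \<noteq> R" "Q \<noteq> R" by (auto simp: card_insert_if split: if_splits)
  moreover have "P \<in> {A, B, C}" "Q \<in> {A, B, C}" "R \<in> {A, B, C}"
    unfolding assms(3)[symmetric] by simp_all
  ultimately have "(P, Q, R) \<in> {(A,B,C), (B,C,A), (C,A,B), (B,A,C), (A,C,B), (C,B,A)}"
    by auto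
  note * = this and 1 = assms(1) and 2 = apollonius_rotate[OF assms(1)]
  note 3 = apollonius_rotate[OF 2] and 4 = apollonius_swap[OF 1] and 5 = apollonius_swap[OF 2]
  note 6 = apollonius_swap[OF 3]
  show ?thesis
    using * 1 2 3 4 5 6 by auto
qed

section \<open>Taxicab transformations as bijective affine isometries\<close>

lemma taxi_transformation_affine:
  assumes "taxi_transformation f"
  shows "f (V + s *\<^sub>R (P - V) + t *\<^sub>R (Q - V)) = f V + s *\<^sub>R (f P - f V) + t *\<^sub>R (f Q - f V)"
  using assms
proof (induction arbitrary: V P Q)
  case (composition f g)
  then show ?case by simp
qed (simp_all add: case_prod_beta prod_eq_iff algebra_simps)

lemma taxi_transformation_dist:
  assumes "taxi_transformation f"
  shows "taxi_dist (f P) (f Q) = taxi_dist P Q"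
  using assms
  by (induction arbitrary: P Q) (auto simp: case_prod_beta taxi_dist_def)

lemma taxi_transformation_surj: "taxi_transformation f \<Longrightarrow> surj f"
proof (induction rule: taxi_transformation.induct)
  case (translation v)
  show ?case by (rule surjI[where f = "\<lambda>P. P - v"]) simp
next
  case reflect_main_diagonal
  show ?case by (rule surjI[where f = "\<lambda>(x, y). (y, x)"]) auto
next
  case reflect_anti_diagonal
  show ?case by (rule surjI[where f = "\<lambda>(x, y). (- y, - x)"]) auto
next
  case reflect_y_axis
  show ?case by (rule surjI[where f = "\<lambda>(x, y). (- x, y)"]) auto
next
  case reflect_x_axis
  show ?case by (rule surjI[where f = "\<lambda>(x, y). (x, - y)"]) auto
next
  case (composition f g)
  then show ?case using comp_surj by blast
qed

lemma taxi_transformation_inj: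
  assumes "taxi_transformation f"
  shows "inj f"
proof (rule injI)
  fix P Q assume "f P = f Q"
  then have "taxi_dist P Q = 0"
    using taxi_transformation_dist[OF assms, of P Q] by (simp add: taxi_dist_def)
  then show "P = Q" unfolding taxi_dist_def prod_eq_iff by linarith
qed

text \<open>A single \<open>cross\<close> changes sign under a reflection; the product of two does
  not, and the half-plane condition only sees the product.\<close>

lemma taxi_transformation_cross:
  assumes "taxi_transformation f"
  shows "cross (f A) (f B) (f Q) * cross (f A) (f B) (f C) = cross A B Q * cross A B C"
  using assms
proof (induction arbitrary: A B C Q)
  case (composition f g)
  then show ?case by simp
qed (simp_all add: case_prod_beta cross_def algebra_simps)

lemma taxi_transformation_circle: "taxi_circle (f X) r = f ` taxi_circle X r"
  and taxi_transformation_disk: "taxi_disk (f X) r = f ` taxi_disk X r"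
  if f: "taxi_transformation f"
  using surjD[OF taxi_transformation_surj[OF f]]
  by (auto simp: taxi_circle_def taxi_disk_def taxi_transformation_dist[OF f] image_iff)
     (metis taxi_transformation_dist[OF f])+

text \<open>Every point set in the definition is carried to its image: the affine formula handles
  the angle, with \<open>t = 0\<close> the rays, and with base point \<open>A\<close> the segment.
  Injectivity then transfers inclusions and intersections in both directions.\<close>

lemma taxi_transformation_is_excircle:
  assumes f: "taxi_transformation f"
  shows "is_excircle (f C) (f A) (f B) (f X) r \<longleftrightarrow> is_excircle C A B X r"
proof -
  note inj = taxi_transformation_inj[OF f]
  have half: "opposite_half_plane (f C) (f A) (f B) = f ` opposite_half_plane C A B"
    using surjD[OF taxi_transformation_surj[OF f]]
    by (auto simp: opposite_half_plane_def taxi_transformation_cross[OF f] image_iff)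
       (metis taxi_transformation_cross[OF f])
  have angle: "angle_region (f C) (f A) (f B) = f ` angle_region C A B"
    unfolding angle_region_def taxi_transformation_affine[OF f, symmetric] by blast
  have ray: "ray (f C) (f P) = f ` ray C P" for P
  proof -
    have "f (C + s *\<^sub>R (P - C)) = f C + s *\<^sub>R (f P - f C)" for s
      using taxi_transformation_affine[OF f, of C s P 0 C] by simp
    then show ?thesis unfolding ray_def by (simp add: setcompr_eq_image image_image) 
  qed
  have seg: "closed_segment (f A) (f B) = f ` closed_segment A B"
  proof -
    have "f ((1 - u) *\<^sub>R A + u *\<^sub>R B) = (1 - u) *\<^sub>R f A + u *\<^sub>R f B" for u
      using taxi_transformation_affine[OF f, of A u B 0 A] by (simp add: algebra_simps)
    then show ?thesis
      unfolding closed_segment_def by (simp add: setcompr_eq_image image_image)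
  qed
  show ?thesis
    unfolding is_excircle_def taxi_transformation_circle[OF f] taxi_transformation_disk[OF f]
      half angle ray seg
    by (simp add: inj_image_subset_iff[OF inj] image_Int[OF inj, symmetric])
qed

lemma taxi_transformation_encompasses:
  assumes f: "taxi_transformation f"
  shows "encompasses_tangentially (f Z) R (f X) r \<longleftrightarrow> encompasses_tangentially Z R X r"
proof -
  note inj = taxi_transformation_inj[OF f]
  show ?thesis
    unfolding encompasses_tangentially_def taxi_transformation_circle[OF f]
      taxi_transformation_disk[OF f]
    by (simp add: inj_image_subset_iff[OF inj] image_Int[OF inj, symmetric])
qed

lemma taxi_transformation_apollonius:
  assumes f: "taxi_transformation f"
  shows "has_taxicab_apollonius_circle (f A) (f B) (f C) \<longleftrightarrow> has_taxicab_apollonius_circle A B C"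
proof -
  have surj: "\<exists>Y. X = f Y" for X
    using taxi_transformation_surj[OF f] by (metis surjD)
  note E = taxi_transformation_is_excircle[OF f] taxi_transformation_encompasses[OF f]
  show ?thesis
  proof
    assume "has_taxicab_apollonius_circle (f A) (f B) (f C)"
    then obtain Xa ra Xb rb Xc rc Z R where *:
      "is_excircle (f A) (f B) (f C) Xa ra" "is_excircle (f B) (f C) (f A) Xb rb"
      "is_excircle (f C) (f A) (f B) Xc rc" "R > 0"
      "encompasses_tangentially Z R Xa ra" "encompasses_tangentially Z R Xb rb"
      "encompasses_tangentially Z R Xc rc"
      unfolding has_taxicab_apollonius_circle_def by blast
    obtain Ya Yb Yc W where "Xa = f Ya" "Xb = f Yb" "Xc = f Yc" "Z = f W"
      using surj by meson
    with * show "has_taxicab_apollonius_circle A B C"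
      unfolding has_taxicab_apollonius_circle_def by (simp only: E) blast
  next
    assume "has_taxicab_apollonius_circle A B C"
    then obtain Xa ra Xb rb Xc rc Z R where
      "is_excircle A B C Xa ra" "is_excircle B C A Xb rb" "is_excircle C A B Xc rc" "R > 0"
      "encompasses_tangentially Z R Xa ra" "encompasses_tangentially Z R Xb rb"
      "encompasses_tangentially Z R Xc rc"
      unfolding has_taxicab_apollonius_circle_def by blast
    then have "is_excircle (f A) (f B) (f C) (f Xa) ra" "is_excircle (f B) (f C) (f A) (f Xb) rb"
      "is_excircle (f C) (f A) (f B) (f Xc) rc" "R > 0"
      "encompasses_tangentially (f Z) R (f Xa) ra" "encompasses_tangentially (f Z) R (f Xb) rb"
      "encompasses_tangentially (f Z) R (f Xc) rc"
      by (simp_all add: E)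
    then show "has_taxicab_apollonius_circle (f A) (f B) (f C)"
      unfolding has_taxicab_apollonius_circle_def by blast
  qed
qed

subsection \<open>Criteria for containment and tangency\<close>

text \<open>Cramer's rule: in the basis \<open>P - V\<close>, \<open>Q - V\<close> the coordinates
  of \<open>X - V\<close> are quotients of cross products by \<open>cross V P Q\<close>. Multiplying
  by that determinant makes the sign test independent of the orientation.\<close>

lemma in_angle_region:
  assumes D: "cross V P Q \<noteq> 0"
    and P: "0 \<le> cross V P X * cross V P Q" and Q: "0 \<le> cross V X Q * cross V P Q"
  shows "X \<in> angle_region V P Q"
proof -
  define D where "D = cross V P Q"
  have *: "fst X - fst V = cross V X Q / D * (fst P - fst V) + cross V P X / D * (fst Q - fst V)"
          "snd X - snd V = cross V X Q / D * (snd P - snd V) + cross V P X / D * (snd Q - snd V)"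
    using D unfolding D_def by (simp_all add: divide_simps) (simp_all add: cross_def algebra_simps)
  have "X = V + (cross V X Q / D) *\<^sub>R (P - V) + (cross V P X / D) *\<^sub>R (Q - V)"
    using * by (simp add: prod_eq_iff)
  moreover have "cross V X Q / D \<ge> 0" "cross V P X / D \<ge> 0"
    using P Q unfolding D_def by (simp_all add: zero_le_divide_iff zero_le_mult_iff)
  ultimately show ?thesis unfolding angle_region_def by blast
qed

text \<open>The dual of the taxicab norm is the maximum norm, so a linear form with coefficients in
  [-1, 1] moves by at most \<open>r\<close> from its value at the centre. Containment of a disk in
  such a half-plane thus becomes one inequality at the centre.\<close>

lemma affine_nonneg_on_taxi_disk:
  assumes ab: "\<bar>a\<bar> \<le> 1" "\<bar>b\<bar> \<le> 1" and r: "r \<le> c + a * fst X + b * snd X"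
    and "Q \<in> taxi_disk X r"
  shows "0 \<le> c + a * fst Q + b * snd Q"
proof -
  have "a * (fst X - fst Q) \<le> \<bar>fst X - fst Q\<bar>" "b * (snd X - snd Q) \<le> \<bar>snd X - snd Q\<bar>"
    using ab by (auto intro: order_trans[OF abs_ge_self] simp: abs_mult mult_left_le_one_le)
  moreover have "\<bar>fst X - fst Q\<bar> + \<bar>snd X - snd Q\<bar> \<le> r"
    using assms(4) by (simp add: taxi_disk_def taxi_dist_def)
  ultimately show ?thesis using r by (simp add: algebra_simps)
qed

lemma encompasses_tangentiallyI:
  assumes d: "taxi_dist Z X + r = R" and "r > 0"
  shows "encompasses_tangentially Z R X r"
proof -
  define z1 z2 x1 x2 where "z1 = fst Z" "z2 = snd Z" "x1 = fst X" "x2 = snd X"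
  note defs = this
  \<comment> \<open>The contact point is the left or right corner of the inner circle, whichever
    points away from \<open>Z\<close>: there the distance from \<open>Z\<close> exceeds that of
    \<open>X\<close> by exactly \<open>r\<close>.\<close>
  define Q where "Q = (x1 + (if z1 \<le> x1 then r else - r), x2)"
  have "taxi_dist X Q = r" "taxi_dist Z Q = R"
    using assms by (auto simp: Q_def taxi_dist_def defs[symmetric])
  then have "Q \<in> taxi_circle Z R \<inter> taxi_circle X r"
    by (simp add: taxi_circle_def)
  moreover have "taxi_circle X r \<subseteq> taxi_disk Z R"
    using d unfolding taxi_circle_def taxi_disk_def taxi_dist_def by clarify linarith
  ultimately show ?thesis unfolding encompasses_tangentially_def by blast
qed

subsection \<open>The normal form\<close>

text \<open>The last two assumptions put \<open>A\<close> and \<open>B\<close> on the line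
  \<open>x = T + k y\<close>, with denominators cleared; \<open>k = 0\<close> is the vertical case.
  Admitting \<open>a = 1\<close> makes room for the diagonal side of type (2).\<close>

locale normal_triangle =
  fixes a b k T x\<^sub>A x\<^sub>B :: real
  assumes slopes: "-1 < b" "b < a" "a \<le> 1" and k: "\<bar>k\<bar> < 1" and T: "T > 0"
    and x\<^sub>A: "x\<^sub>A * (1 - k * b) = T" and x\<^sub>B: "x\<^sub>B * (1 - k * a) = T"
begin

definition A :: point where "A = (x\<^sub>A, b * x\<^sub>A)"
definition B :: point where "B = (x\<^sub>B, a * x\<^sub>B)"
definition C :: point where "C = (0, 0)"

section \<open>Coordinates for the sides of the normal form\<close>

lemma denominators_pos: "1 - k * a > 0" "1 - k * b > 0"
proof -
  have "\<bar>k * m\<bar> < 1" if "\<bar>m\<bar> \<le> 1" for m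
    using mult_left_mono[OF that, of "\<bar>k\<bar>"] k by (simp add: abs_mult)
  from this[of a] this[of b] show "1 - k * a > 0" "1 - k * b > 0"
    using slopes by linarith+
qed

lemma x_pos: "x\<^sub>A > 0" "x\<^sub>B > 0"
  using x\<^sub>A x\<^sub>B T denominators_pos by (metis zero_less_mult_pos2)+

lemma line_AB: "x\<^sub>A = T + k * (b * x\<^sub>A)" "x\<^sub>B = T + k * (a * x\<^sub>B)"
  using x\<^sub>A x\<^sub>B by (simp_all add: algebra_simps)

text \<open>The line of slope \<open>m\<close> through the apex meets \<open>AB\<close> at height
  \<open>m T / (1 - k m)\<close>, which increases with \<open>m\<close>. Besides the slopes of the
  sides, this serves for the slopes 1 and -1 of the contact points below.\<close>

lemma height_less_iff:
  assumes "x * (1 - k * m) = T" "1 - k * m > 0" "x' * (1 - k * m') = T" "1 - k * m' > 0"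
  shows "m * x < m' * x' \<longleftrightarrow> m < m'"
proof -
  have "x = T / (1 - k * m)" "x' = T / (1 - k * m')" using assms by (auto simp: field_simps)
  then have "m * x < m' * x' \<longleftrightarrow> (m * T) * (1 - k * m') < (m' * T) * (1 - k * m)"
    using assms by (simp add: pos_divide_less_eq pos_less_divide_eq mult.commute mult.left_commute)
  also have "\<dots> \<longleftrightarrow> T * m < T * m'" by (simp add: algebra_simps)
  finally show ?thesis using T by simp
qed

lemma y_less: "b * x\<^sub>A < a * x\<^sub>B"
  using height_less_iff[of x\<^sub>A b x\<^sub>B a] x\<^sub>A x\<^sub>B denominators_pos slopes by simp

text \<open>All leading factors are positive, so each side-of-a-line test reduces to the sign of the
  linear form in the second factor.\<close>

lemma cross_eqs:
  "cross C A Q = x\<^sub>A * (snd Q - b * fst Q)"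
  "cross A C Q = x\<^sub>A * (b * fst Q - snd Q)"
  "cross C B Q = x\<^sub>B * (snd Q - a * fst Q)"
  "cross B C Q = x\<^sub>B * (a * fst Q - snd Q)"
  "cross A B Q = (a * x\<^sub>B - b * x\<^sub>A) * (T + k * snd Q - fst Q)"
  "cross B A Q = (a * x\<^sub>B - b * x\<^sub>A) * (fst Q - T - k * snd Q)"
proof -
  have "cross A B Q = (x\<^sub>B - x\<^sub>A) * (snd Q - b * x\<^sub>A) - (a * x\<^sub>B - b * x\<^sub>A) * (fst Q - x\<^sub>A)"
    by (simp add: A_def B_def cross_def)
  also have "x\<^sub>B - x\<^sub>A = k * (a * x\<^sub>B - b * x\<^sub>A)" using line_AB by (simp add: algebra_simps)
  also have "fst Q - x\<^sub>A = fst Q - T - k * (b * x\<^sub>A)" using line_AB by simp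
  finally show *: "cross A B Q = (a * x\<^sub>B - b * x\<^sub>A) * (T + k * snd Q - fst Q)"
    by (simp add: algebra_simps)
  have "cross B A Q = - cross A B Q" by (simp add: cross_def algebra_simps)
  then show "cross B A Q = (a * x\<^sub>B - b * x\<^sub>A) * (fst Q - T - k * snd Q)"
    using * by (simp add: algebra_simps)
qed (simp_all add: A_def B_def C_def cross_def algebra_simps)

text \<open>The height \<open>y\<close> serves as affine parameter on the line \<open>AB\<close>, so
  membership in its rays and in the segment becomes a comparison of heights.\<close>

lemma on_line_AB:
  "(T + k * y, y) = A + ((y - b * x\<^sub>A) / (a * x\<^sub>B - b * x\<^sub>A)) *\<^sub>R (B - A)"
proof -
  let ?s = "(y - b * x\<^sub>A) / (a * x\<^sub>B - b * x\<^sub>A)"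
  have s: "?s * (a * x\<^sub>B - b * x\<^sub>A) = y - b * x\<^sub>A" using y_less by simp
  have "?s * (x\<^sub>B - x\<^sub>A) = k * (?s * (a * x\<^sub>B - b * x\<^sub>A))"
    using line_AB by (metis (no_types) add_diff_cancel_left mult.left_commute right_diff_distrib')
  then have "x\<^sub>A + ?s * (x\<^sub>B - x\<^sub>A) = T + k * (b * x\<^sub>A) + k * (y - b * x\<^sub>A)"
    unfolding s using line_AB by simp
  then have "x\<^sub>A + ?s * (x\<^sub>B - x\<^sub>A) = T + k * y"
    by (simp add: right_diff_distrib)
  then show ?thesis using s by (simp add: A_def B_def)
qed

lemma in_ray_AB: "b * x\<^sub>A \<le> y \<Longrightarrow> (T + k * y, y) \<in> ray A B"
  unfolding ray_def on_line_AB using y_less by force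

lemma in_ray_BA:
  assumes "y \<le> a * x\<^sub>B"
  shows "(T + k * y, y) \<in> ray B A"
proof -
  let ?s = "(y - b * x\<^sub>A) / (a * x\<^sub>B - b * x\<^sub>A)"
  have "?s \<le> 1" using y_less assms by simp
  moreover have "(T + k * y, y) = B + (1 - ?s) *\<^sub>R (A - B)"
    unfolding on_line_AB by (simp add: algebra_simps)
  ultimately show ?thesis unfolding ray_def by force
qed

lemma in_segment_AB:
  assumes "b * x\<^sub>A \<le> y" "y \<le> a * x\<^sub>B"
  shows "(T + k * y, y) \<in> closed_segment A B"
proof -
  let ?s = "(y - b * x\<^sub>A) / (a * x\<^sub>B - b * x\<^sub>A)"
  have "0 \<le> ?s" "?s \<le> 1" using y_less assms by simp_all
  moreover have "(T + k * y, y) = (1 - ?s) *\<^sub>R A + ?s *\<^sub>R B"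
    unfolding on_line_AB by (simp add: algebra_simps)
  ultimately show ?thesis unfolding closed_segment_def by blast
qed

section \<open>The three excircles\<close>

lemma apex_in:
  "C \<in> ray A C" "C \<in> ray B C" "C \<in> closed_segment B C" "C \<in> closed_segment C A"
  unfolding ray_def by (auto intro: exI[of _ 1])

text \<open>The bottom corner of the circle is \<open>C\<close>, which gives contact with both
  \<open>BC\<close> and the ray from \<open>A\<close> through \<open>C\<close>. The hypothesis says
  that the right corner \<open>(\<rho>, \<rho>)\<close> lies on the line \<open>AB\<close>.\<close>

lemma excircle_A:
  assumes \<rho>: "\<rho> * (1 - k) = T"
  shows "is_excircle A B C (0, \<rho>) \<rho>"
proof -
  have pos: "\<rho> > 0" using \<rho> T k by (metis abs_less_iff diff_gt_0_iff_gt zero_less_mult_pos2)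
  have disk: "a * fst Q \<le> snd Q \<and> b * fst Q \<le> snd Q \<and> fst Q \<le> T + k * snd Q"
    if "Q \<in> taxi_disk (0, \<rho>) \<rho>" for Q
  proof -
    have "\<bar>a\<bar> \<le> 1" "\<bar>b\<bar> \<le> 1" using slopes by auto
    \<comment> \<open>At the centre all three linear forms take exactly the value
      \<open>\<rho>\<close>, the least value that the criterion allows.\<close>
    then show ?thesis
      using affine_nonneg_on_taxi_disk[OF _ _ _ that, where a = "-a" and b = 1 and c = 0]
        affine_nonneg_on_taxi_disk[OF _ _ _ that, where a = "-b" and b = 1 and c = 0]
        affine_nonneg_on_taxi_disk[OF _ _ _ that, where a = "-1" and b = k and c = T] k pos \<rho>
      by (simp add: algebra_simps)
  qed
  have "taxi_disk (0, \<rho>) \<rho> \<subseteq> angle_region A B C"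
  proof
    fix Q assume "Q \<in> taxi_disk (0, \<rho>) \<rho>"
    note Q = disk[OF this]
    have D: "cross A B C > 0" using y_less T by (simp add: cross_eqs) (simp add: C_def)
    have "cross A B Q \<ge> 0" using Q y_less by (simp add: cross_eqs)
    moreover have "cross A Q C = x\<^sub>A * (snd Q - b * fst Q)"
      by (simp add: cross_def A_def C_def algebra_simps)
    then have "cross A Q C \<ge> 0" using Q x_pos by simp
    ultimately show "Q \<in> angle_region A B C" using D by (intro in_angle_region) auto
  qed
  moreover have "taxi_disk (0, \<rho>) \<rho> \<subseteq> opposite_half_plane A B C"
  proof
    fix Q assume "Q \<in> taxi_disk (0, \<rho>) \<rho>"
    note Q = disk[OF this]
    have "cross B C Q \<le> 0" using Q x_pos by (simp add: cross_eqs mult_le_0_iff)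
    moreover have "cross B C A \<ge> 0"
      using x_pos slopes by (simp add: cross_eqs) (simp add: A_def)
    ultimately show "Q \<in> opposite_half_plane A B C"
      by (simp add: opposite_half_plane_def mult_nonpos_nonneg)
  qed
  moreover have "C \<in> taxi_circle (0, \<rho>) \<rho>"
    using pos by (simp add: taxi_circle_def taxi_dist_def C_def)
  moreover have "(\<rho>, \<rho>) \<in> ray A B \<inter> taxi_circle (0, \<rho>) \<rho>"
  proof -
    \<comment> \<open>The right corner is where the line of slope 1 through \<open>C\<close> meets
      \<open>AB\<close>; as \<open>b < 1\<close>, it lies above \<open>A\<close>.\<close>
    have "b * x\<^sub>A < 1 * \<rho>"
      using height_less_iff[of x\<^sub>A b \<rho> 1] x\<^sub>A \<rho> denominators_pos slopes k by simp
    moreover have "\<rho> = T + k * \<rho>" using \<rho> by (simp add: algebra_simps)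
    ultimately have "(\<rho>, \<rho>) \<in> ray A B" using in_ray_AB[of \<rho>] by simp
    then show ?thesis using pos by (simp add: taxi_circle_def taxi_dist_def)
  qed
  ultimately show ?thesis
    unfolding is_excircle_def using pos apex_in by blast
qed

text \<open>The mirror image of \<open>excircle_A\<close> in the x-axis: now the top corner is
  \<open>C\<close> and the right corner \<open>(\<rho>, - \<rho>)\<close> lies on \<open>AB\<close>.
  Reflection turns the slopes \<open>b\<close>, \<open>a\<close> into \<open>- a\<close>,
  \<open>- b\<close>, which leaves the locale when \<open>a = 1\<close>, so the argument is
  repeated.\<close>

lemma excircle_B:
  assumes \<rho>: "\<rho> * (1 + k) = T"
  shows "is_excircle B C A (0, - \<rho>) \<rho>"
proof -
  have pos: "\<rho> > 0" using \<rho> T k by (smt (verit) zero_less_mult_pos2)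
  have disk: "snd Q \<le> a * fst Q \<and> snd Q \<le> b * fst Q \<and> fst Q \<le> T + k * snd Q"
    if "Q \<in> taxi_disk (0, - \<rho>) \<rho>" for Q
  proof -
    have "\<bar>a\<bar> \<le> 1" "\<bar>b\<bar> \<le> 1" using slopes by auto
    then show ?thesis
      using affine_nonneg_on_taxi_disk[OF _ _ _ that, where a = a and b = "-1" and c = 0]
        affine_nonneg_on_taxi_disk[OF _ _ _ that, where a = b and b = "-1" and c = 0]
        affine_nonneg_on_taxi_disk[OF _ _ _ that, where a = "-1" and b = k and c = T] k pos \<rho>
      by (simp add: algebra_simps)
  qed
  have "taxi_disk (0, - \<rho>) \<rho> \<subseteq> angle_region B C A"
  proof
    fix Q assume "Q \<in> taxi_disk (0, - \<rho>) \<rho>"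
    note Q = disk[OF this]
    have D: "cross B C A > 0" using x_pos slopes by (simp add: cross_eqs) (simp add: A_def)
    have "cross B C Q \<ge> 0" using Q x_pos by (simp add: cross_eqs)
    moreover have "cross B Q A = cross A B Q" by (simp add: cross_def algebra_simps)
    then have "cross B Q A \<ge> 0" using Q y_less by (simp add: cross_eqs)
    ultimately show "Q \<in> angle_region B C A" using D by (intro in_angle_region) auto
  qed
  moreover have "taxi_disk (0, - \<rho>) \<rho> \<subseteq> opposite_half_plane B C A"
  proof
    fix Q assume "Q \<in> taxi_disk (0, - \<rho>) \<rho>"
    note Q = disk[OF this]
    have "cross C A Q \<le> 0" using Q x_pos by (simp add: cross_eqs mult_le_0_iff)
    moreover have "cross C A B \<ge> 0"
      using x_pos slopes by (simp add: cross_eqs) (simp add: B_def)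
    ultimately show "Q \<in> opposite_half_plane B C A"
      by (simp add: opposite_half_plane_def mult_nonpos_nonneg)
  qed
  moreover have "C \<in> taxi_circle (0, - \<rho>) \<rho>"
    using pos by (simp add: taxi_circle_def taxi_dist_def C_def)
  moreover have "(\<rho>, - \<rho>) \<in> ray B A \<inter> taxi_circle (0, - \<rho>) \<rho>"
  proof -
    have "- 1 * \<rho> < a * x\<^sub>B"
      using height_less_iff[of \<rho> "-1" x\<^sub>B a] x\<^sub>B \<rho> denominators_pos slopes k by simp
    moreover have "\<rho> = T + k * - \<rho>" using \<rho> by (simp add: algebra_simps)
    ultimately have "(\<rho>, - \<rho>) \<in> ray B A" using in_ray_BA[of "- \<rho>"] by simp
    then show ?thesis using pos by (simp add: taxi_circle_def taxi_dist_def)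
  qed
  ultimately show ?thesis
    unfolding is_excircle_def using pos apex_in by blast
qed

text \<open>The vertical diameter is the chord cut out of the angle at \<open>C\<close> by the line
  \<open>x = L\<close>, so the top and bottom corners touch the two rays. The second hypothesis
  places the left corner on the line \<open>AB\<close>.\<close>

lemma excircle_C:
  assumes L: "L > 0" and tangent: "L - L * (a - b) / 2 = T + k * (L * (a + b) / 2)"
  shows "is_excircle C A B (L, L * (a + b) / 2) (L * (a - b) / 2)"
proof -
  define r where "r = L * (a - b) / 2"
  define y where "y = L * (a + b) / 2"
  have pos: "r > 0" using L slopes by (simp add: r_def)
  have yr: "y + r = L * a" "y - r = L * b"
    by (simp_all add: y_def r_def algebra_simps diff_divide_distrib add_divide_distrib)
  have tangent': "L - r = T + k * y" using tangent by (simp add: r_def y_def)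
  have disk: "snd Q \<le> a * fst Q \<and> b * fst Q \<le> snd Q \<and> T + k * snd Q \<le> fst Q"
    if "Q \<in> taxi_disk (L, y) r" for Q
  proof -
    have "\<bar>a\<bar> \<le> 1" "\<bar>b\<bar> \<le> 1" using slopes by auto
    then show ?thesis
      using affine_nonneg_on_taxi_disk[OF _ _ _ that, where a = a and b = "-1" and c = 0]
        affine_nonneg_on_taxi_disk[OF _ _ _ that, where a = "-b" and b = 1 and c = 0]
        affine_nonneg_on_taxi_disk[OF _ _ _ that, where a = "1" and b = "-k" and c = "-T"] k pos yr tangent'
      by (simp add: algebra_simps)
  qed
  have "taxi_disk (L, y) r \<subseteq> angle_region C A B"
  proof
    fix Q assume "Q \<in> taxi_disk (L, y) r"
    note Q = disk[OF this]
    have D: "cross C A B > 0" using x_pos slopes by (simp add: cross_eqs) (simp add: B_def)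
    have "cross C A Q \<ge> 0" using Q x_pos by (simp add: cross_eqs)
    moreover have "cross C Q B = cross B C Q" by (simp add: cross_def algebra_simps)
    then have "cross C Q B \<ge> 0" using Q x_pos by (simp add: cross_eqs)
    ultimately show "Q \<in> angle_region C A B" using D by (intro in_angle_region) auto
  qed
  moreover have "taxi_disk (L, y) r \<subseteq> opposite_half_plane C A B"
  proof
    fix Q assume "Q \<in> taxi_disk (L, y) r"
    note Q = disk[OF this]
    have "cross A B Q \<le> 0" using Q y_less by (simp add: cross_eqs mult_le_0_iff)
    moreover have "cross A B C \<ge> 0"
      using y_less T by (simp add: cross_eqs) (simp add: C_def)
    ultimately show "Q \<in> opposite_half_plane C A B"
      by (simp add: opposite_half_plane_def mult_nonpos_nonneg)
  qed
  moreover have "(L, L * b) \<in> ray C A \<inter> taxi_circle (L, y) r"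
  proof -
    have "(L, L * b) = C + (L / x\<^sub>A) *\<^sub>R (A - C)" "L / x\<^sub>A \<ge> 0"
      using x_pos L by (simp_all add: A_def C_def)
    then have "(L, L * b) \<in> ray C A" unfolding ray_def by blast
    then show ?thesis using pos yr by (simp add: taxi_circle_def taxi_dist_def)
  qed
  moreover have "(L, L * a) \<in> ray C B \<inter> taxi_circle (L, y) r"
  proof -
    have "(L, L * a) = C + (L / x\<^sub>B) *\<^sub>R (B - C)" "L / x\<^sub>B \<ge> 0"
      using x_pos L by (simp_all add: B_def C_def)
    then have "(L, L * a) \<in> ray C B" unfolding ray_def by blast
    then show ?thesis using pos yr by (simp add: taxi_circle_def taxi_dist_def)
  qed
  moreover have "(L - r, y) \<in> closed_segment A B \<inter> taxi_circle (L, y) r"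
  proof -
    \<comment> \<open>Since the slopes are at most 1 in absolute value, the left corner stays within
      the angle at \<open>C\<close>; being on the line \<open>AB\<close>, it then lies on the
      segment.\<close>
    have 0: "r * b \<le> r * 1" "r * (- b) \<le> r * 1" "r * a \<le> r * 1" "r * (- a) \<le> r * 1"
      using slopes pos by (intro mult_left_mono; linarith)+
    have "b * (L - r) \<le> y" "y \<le> a * (L - r)"
      using 0 yr by (simp_all add: algebra_simps)
    \<comment> \<open>Replacing \<open>L - r\<close> by \<open>T + k * y\<close> and then
      \<open>T\<close> by the defining products of \<open>x\<^sub>A\<close> and
      \<open>x\<^sub>B\<close> leaves common positive factors to cancel.\<close>
    then have "b * T \<le> y * (1 - k * b)" "y * (1 - k * a) \<le> a * T"
      unfolding tangent' by (simp_all add: algebra_simps)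
    then have "b * x\<^sub>A * (1 - k * b) \<le> y * (1 - k * b)" "y * (1 - k * a) \<le> a * x\<^sub>B * (1 - k * a)"
      using x\<^sub>A x\<^sub>B by (simp_all add: mult.assoc)
    then have "b * x\<^sub>A \<le> y" "y \<le> a * x\<^sub>B"
      using denominators_pos by simp_all
    then show ?thesis
      using in_segment_AB[of y] pos by (simp add: tangent' taxi_circle_def taxi_dist_def flip: tangent')
  qed
  ultimately show ?thesis
    unfolding is_excircle_def r_def[symmetric] y_def[symmetric] using pos by blast
qed

lemma apollonius:
  assumes cond: "k \<le> b * k + 2 * a - b - 1 \<or> 1 - a + 2 * b - a * k \<le> k"
  shows "has_taxicab_apollonius_circle A B C"
proof -
  \<comment> \<open>Solving the tangency equation of \<open>excircle_C\<close> for \<open>L\<close>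
    gives \<open>2 * T / D\<close>; this form of \<open>D\<close> shows that it is positive.\<close>
  define D where "D = (1 - a) * (1 + k) + (1 + b) * (1 - k)"
  have D: "D > 0" unfolding D_def using slopes k
    by (intro add_nonneg_pos[OF mult_nonneg_nonneg mult_pos_pos]) auto
  define L where "L = 2 * T / D"
  define \<rho> where "\<rho> = T / (1 - k)"
  define \<sigma> where "\<sigma> = T / (1 + k)"
  define R where "R = max (L * (1 + a) / 2 + \<sigma>) (L * (1 - b) / 2 + \<rho>)"
  have L: "L > 0" and \<rho>: "\<rho> * (1 - k) = T" "\<rho> > 0" and \<sigma>: "\<sigma> * (1 + k) = T" "\<sigma> > 0"
    using D T k by (auto simp: L_def \<rho>_def \<sigma>_def)
  have LD: "L * D = 2 * T" using D by (simp add: L_def)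
  have C: "is_excircle C A B (L, L * (a + b) / 2) (L * (a - b) / 2)"
    using LD L by (intro excircle_C) (auto simp: D_def field_simps)
  have R: "\<rho> + \<sigma> \<le> R"
    using cond
  proof
    assume "k \<le> b * k + 2 * a - b - 1"
    \<comment> \<open>Multiplied by \<open>L\<close>, this compares \<open>2 * T\<close>, which is
      \<open>2 * \<rho> * (1 - k)\<close>, with \<open>L * (1 + a) * (1 - k)\<close>: the first
      disjunct says that \<open>\<rho>\<close> is at most \<open>L * (1 + a) / 2\<close>. The second
      one bounds \<open>\<sigma>\<close> likewise by \<open>L * (1 - b) / 2\<close>.\<close>
    then have "D \<le> (1 + a) * (1 - k)" by (simp add: D_def algebra_simps)
    then have "L * D \<le> L * ((1 + a) * (1 - k))" using L by simp
    then have "(2 * \<rho>) * (1 - k) \<le> (L * (1 + a)) * (1 - k)" using LD \<rho> by (simp add: mult.assoc)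
    then have "2 * \<rho> \<le> L * (1 + a)" by (rule mult_right_le_imp_le) (use k in auto)
    then show ?thesis by (simp add: R_def)
  next
    assume "1 - a + 2 * b - a * k \<le> k"
    then have "D \<le> (1 - b) * (1 + k)" by (simp add: D_def algebra_simps)
    then have "L * D \<le> L * ((1 - b) * (1 + k))" using L by simp
    then have "(2 * \<sigma>) * (1 + k) \<le> (L * (1 - b)) * (1 + k)" using LD \<sigma> by (simp add: mult.assoc)
    then have "2 * \<sigma> \<le> L * (1 - b)" by (rule mult_right_le_imp_le) (use k in auto)
    then show ?thesis by (simp add: R_def)
  qed
  \<comment> \<open>The first coordinate is nonnegative, so it is the horizontal distance to both
    centres on the y-axis; the vertical distances are \<open>\<sigma>\<close> and
    \<open>\<rho>\<close>.\<close>
  let ?Z = "(R - \<rho> - \<sigma>, \<rho> - \<sigma>)"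
  have "encompasses_tangentially ?Z R (0, \<rho>) \<rho>"
    using R \<rho> \<sigma> by (intro encompasses_tangentiallyI) (auto simp: taxi_dist_def)
  moreover have "encompasses_tangentially ?Z R (0, - \<sigma>) \<sigma>"
    using R \<rho> \<sigma> by (intro encompasses_tangentiallyI) (auto simp: taxi_dist_def)
  moreover have "encompasses_tangentially ?Z R (L, L * (a + b) / 2) (L * (a - b) / 2)"
  proof (rule encompasses_tangentiallyI)
    define p q where "p = L * a" "q = L * b"
    note pq = this
    \<comment> \<open>These bounds make \<open>R - \<rho> - \<sigma>\<close> at most
      \<open>L\<close>, which settles the sign of the horizontal difference. The other absolute
      value turns the equation for \<open>R\<close> into the maximum of two terms.\<close>
    have "- L \<le> q" "p \<le> L" "q \<le> p"
      using L slopes mult_left_mono[of "-1" b L] mult_left_mono[of a 1 L] mult_left_mono[of b a L]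
      by (auto simp: pq)
    moreover have "2 * R = max (L + p + 2 * \<sigma>) (L - q + 2 * \<rho>)"
    proof -
      have "R = max ((L + p) / 2 + \<sigma>) ((L - q) / 2 + \<rho>)"
        by (simp add: R_def pq algebra_simps)
      then show ?thesis by (auto simp: max_def field_simps)
    qed
    ultimately have "\<bar>(R - \<rho> - \<sigma>) - L\<bar> + \<bar>(\<rho> - \<sigma>) - (p + q) / 2\<bar> + (p - q) / 2 = R"
      using R \<rho>(2) \<sigma>(2) by (auto simp: abs_if max_def field_simps split: if_splits)
    then show "taxi_dist ?Z (L, L * (a + b) / 2) + L * (a - b) / 2 = R"
      by (simp add: taxi_dist_def pq distrib_left right_diff_distrib)
    show "L * (a - b) / 2 > 0" using L slopes by simp
  qed
  moreover have "R > 0" using R \<rho> \<sigma> by simp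
  ultimately show ?thesis
    unfolding has_taxicab_apollonius_circle_def
    using excircle_A[OF \<rho>(1)] excircle_B[OF \<sigma>(1)] C by blast
qed

end

section \<open>From the normal form to triangles in general position\<close>

lemma taxi_transformation_point_reflection: "taxi_transformation (\<lambda>P. - P)"
proof -
  have "(\<lambda>P::point. - P) = (\<lambda>(x, y). (- x, y)) \<circ> (\<lambda>(x, y). (x, - y))"
    by (auto simp: fun_eq_iff)
  then show ?thesis
    by (metis taxi_transformation.composition taxi_transformation.reflect_x_axis
        taxi_transformation.reflect_y_axis)
qed

text \<open>A translation moves \<open>C\<close> to the origin. The equation for \<open>AB\<close>
  forces \<open>x\<^sub>A\<close> and \<open>x\<^sub>B\<close> to have the same sign, so the
  triangle lies on one side of \<open>C\<close>.\<close>

lemma apollonius_of_slopes: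
  fixes A B C :: point
  assumes slopes: "-1 < b" "b < a" "a \<le> 1" and k: "\<bar>k\<bar> < 1"
    and x: "x\<^sub>A \<noteq> 0"
    and A: "A = C + (x\<^sub>A, b * x\<^sub>A)" and B: "B = C + (x\<^sub>B, a * x\<^sub>B)"
    and AB: "x\<^sub>B - x\<^sub>A = k * (a * x\<^sub>B - b * x\<^sub>A)"
    and cond: "k \<le> b * k + 2 * a - b - 1 \<or> 1 - a + 2 * b - a * k \<le> k"
  shows "has_taxicab_apollonius_circle A B C"
proof -
  have T: "x\<^sub>B * (1 - k * a) = x\<^sub>A * (1 - k * b)" using AB by (simp add: algebra_simps)
  have "\<bar>k * b\<bar> < 1"
    using mult_left_mono[of "\<bar>b\<bar>" 1 "\<bar>k\<bar>"] slopes k by (simp add: abs_mult abs_le_iff)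
  then have kb: "1 - k * b > 0" by linarith
  have A': "A - C = (x\<^sub>A, b * x\<^sub>A)" and B': "B - C = (x\<^sub>B, a * x\<^sub>B)" using A B by auto
  have "has_taxicab_apollonius_circle (A + - C) (B + - C) (C + - C)"
  proof (cases "x\<^sub>A > 0")
    case True
    then interpret normal_triangle a b k "x\<^sub>A * (1 - k * b)" x\<^sub>A x\<^sub>B
      using assms T kb by unfold_locales auto
    show ?thesis using apollonius[OF cond] A' B' by (simp add: A_def B_def C_def zero_prod_def)
  next
    case False
    \<comment> \<open>Point reflection in \<open>C\<close> preserves all slopes, so only the signs
      of the abscissas and of the intercept change.\<close>
    then interpret normal_triangle a b k "- x\<^sub>A * (1 - k * b)" "- x\<^sub>A" "- x\<^sub>B"
      using assms T kb by unfold_locales (auto simp: mult_less_0_iff)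
    have "has_taxicab_apollonius_circle (- (A + - C)) (- (B + - C)) (- (C + - C))"
      using apollonius[OF cond] A' B' by (simp add: A_def B_def C_def zero_prod_def)
    then show ?thesis
      using taxi_transformation_apollonius[OF taxi_transformation_point_reflection] by blast
  qed
  then show ?thesis
    using taxi_transformation_apollonius[OF taxi_transformation.translation] by blast
qed


section \<open>Slopes of sides, and triangles of type (2)\<close>

lemma slope_commute: "slope P Q = slope Q P"
  unfolding slope_def by (metis minus_diff_eq minus_divide_divide)

lemma vertical_commute: "vertical P Q = vertical Q P"
  by (auto simp: vertical_def)

lemma diagonal_commute: "diagonal P Q = diagonal Q P"
  and shallow_commute: "shallow P Q = shallow Q P"
  and steep_commute: "steep P Q = steep Q P"
  by (simp_all add: diagonal_def shallow_def steep_def slope_commute vertical_commute)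

lemma snd_diff_eq_slope:
  "\<not> vertical P Q \<Longrightarrow> snd Q - snd P = slope P Q * (fst Q - fst P)"
  by (simp add: slope_def vertical_def)

lemma steepE:
  assumes "steep P Q"
  obtains k where "\<bar>k\<bar> < 1" "fst Q - fst P = k * (snd Q - snd P)"
proof (cases "vertical P Q")
  case True
  then show ?thesis using that[of 0] by (simp add: vertical_def)
next
  case False
  then have "\<bar>slope P Q\<bar> > 1" using assms by (simp add: steep_def)
  then have "\<bar>1 / slope P Q\<bar> < 1" "slope P Q \<noteq> 0" by (auto simp: divide_simps)
  then show ?thesis using that[of "1 / slope P Q"] snd_diff_eq_slope[OF False] by simp
qed

text \<open>The role of the apex is given to the vertex where the shallow and the diagonal side
  meet, so that \<open>a = 1\<close> and \<open>b\<close> is the shallow slope.\<close>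

lemma apollonius_of_ascending_side:
  assumes CA: "shallow C A" and CB: "\<not> vertical C B" "slope C B = 1" and AB: "steep A B"
  shows "has_taxicab_apollonius_circle A B C"
proof -
  obtain k where k: "\<bar>k\<bar> < 1" "fst B - fst A = k * (snd B - snd A)"
    using AB by (rule steepE)
  define b where "b = slope C A"
  have b: "-1 < b" "b < 1" using CA by (auto simp: shallow_def b_def)
  have A: "snd A - snd C = b * (fst A - fst C)" "fst A \<noteq> fst C"
    using CA snd_diff_eq_slope[of C A] by (auto simp: shallow_def b_def vertical_def)
  have B: "snd B - snd C = fst B - fst C"
    using CB snd_diff_eq_slope[of C B] by simp
  have "0 \<le> (1 - b) * (1 - k)" using b k by simp
  then have "k \<le> b * k + 2 * 1 - b - 1" by (simp add: algebra_simps)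
  moreover have "(fst B - fst C) - (fst A - fst C) =
      k * (1 * (fst B - fst C) - b * (fst A - fst C))"
    using k A B by simp
  moreover have "A = C + (fst A - fst C, b * (fst A - fst C))"
    "B = C + (fst B - fst C, 1 * (fst B - fst C))"
    using A B by (simp_all add: prod_eq_iff algebra_simps)
  ultimately show ?thesis
    using b k A by (intro apollonius_of_slopes[of b 1 k "fst A - fst C" A C B "fst B - fst C"]) auto
qed

text \<open>Reflection in the x-axis negates slopes: it turns a descending diagonal into an
  ascending one and keeps the other two sides shallow and steep.\<close>

lemma apollonius_of_diagonal_side:
  assumes CA: "shallow C A" and CB: "diagonal C B" and AB: "steep A B"
  shows "has_taxicab_apollonius_circle A B C"
proof (cases "slope C B = 1")
  case True
  then show ?thesis
    using assms apollonius_of_ascending_side by (simp add: diagonal_def)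
next
  case False
  define f :: "point \<Rightarrow> point" where "f = (\<lambda>(x, y). (x, - y))"
  have vertical: "vertical (f P) (f Q) = vertical P Q" for P Q
    by (simp add: f_def vertical_def case_prod_beta)
  have slope: "slope (f P) (f Q) = - slope P Q" for P Q
    by (simp add: f_def slope_def case_prod_beta) (metis minus_diff_eq minus_diff_minus minus_divide_left)
  have "has_taxicab_apollonius_circle (f A) (f B) (f C)"
    using assms False
    by (intro apollonius_of_ascending_side)
       (auto simp: shallow_def diagonal_def steep_def vertical slope)
  moreover have "taxi_transformation f"
    unfolding f_def by (rule taxi_transformation.reflect_x_axis)
  ultimately show ?thesis using taxi_transformation_apollonius by blast
qed

lemma apollonius_of_two_nondiagonal_sides:
  assumes "nondiagonal_sides_shallow_and_steep A B C"
  shows "has_taxicab_apollonius_circle A B C"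
proof -
  obtain P Q R S where eq: "{(X, Y) \<in> sides A B C. \<not> diagonal X Y} = {(P, Q), (R, S)}"
    and sh: "shallow P Q" and st: "steep R S"
    using assms unfolding nondiagonal_sides_shallow_and_steep_def by blast
  have mem: "(P, Q) \<in> sides A B C" "(R, S) \<in> sides A B C" using eq by blast+
  have third: "diagonal X Y" if "(X, Y) \<in> sides A B C" "(X, Y) \<noteq> (P, Q)" "(X, Y) \<noteq> (R, S)" for X Y
    using eq that by blast
  \<comment> \<open>Two of the cyclically oriented sides coincide as pairs only if all vertices
    coincide. Hence this inequality ensures that the third side differs from the two listed ones and
    is diagonal.\<close>
  have PQ: "P \<noteq> Q" using sh by (auto simp: shallow_def vertical_def)
  have "(P, Q) \<noteq> (R, S)" using sh st by (auto simp: shallow_def steep_def)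
  moreover have "(P, Q) = (B, C) \<or> (P, Q) = (C, A) \<or> (P, Q) = (A, B)"
    "(R, S) = (B, C) \<or> (R, S) = (C, A) \<or> (R, S) = (A, B)"
    using mem by (simp_all add: sides_def)
  ultimately consider "(P, Q) = (B, C)" "(R, S) = (C, A)" | "(P, Q) = (B, C)" "(R, S) = (A, B)"
    | "(P, Q) = (C, A)" "(R, S) = (B, C)" | "(P, Q) = (C, A)" "(R, S) = (A, B)"
    | "(P, Q) = (A, B)" "(R, S) = (B, C)" | "(P, Q) = (A, B)" "(R, S) = (C, A)"
    by metis
  then show ?thesis
  proof cases
    case 1
    then have "has_taxicab_apollonius_circle C A B"
      using PQ sh st third[of A B]
      by (intro apollonius_of_diagonal_side) (auto simp: sides_def shallow_commute diagonal_commute)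
    then show ?thesis using apollonius_rotate by blast
  next
    case 2
    then have "has_taxicab_apollonius_circle B A C"
      using PQ sh st third[of C A]
      by (intro apollonius_of_diagonal_side) (auto simp: sides_def steep_commute shallow_commute)
    then show ?thesis using apollonius_swap by blast
  next
    case 3
    then have "has_taxicab_apollonius_circle C B A"
      using PQ sh st third[of A B]
      by (intro apollonius_of_diagonal_side) (auto simp: sides_def steep_commute shallow_commute)
    then show ?thesis using apollonius_rotate apollonius_swap by blast
  next
    case 4
    then have "has_taxicab_apollonius_circle A B C"
      using PQ sh st third[of B C]
      by (intro apollonius_of_diagonal_side) (auto simp: sides_def diagonal_commute)
    then show ?thesis .
  next
    case 5
    then have "has_taxicab_apollonius_circle B C A"
      using PQ sh st third[of C A]
      by (intro apollonius_of_diagonal_side) (auto simp: sides_def shallow_commute diagonal_commute)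
    then show ?thesis using apollonius_rotate by blast
  next
    case 6
    then have "has_taxicab_apollonius_circle A C B"
      using PQ sh st third[of B C]
      by (intro apollonius_of_diagonal_side) (auto simp: sides_def steep_commute shallow_commute)
    then show ?thesis using apollonius_rotate apollonius_swap by blast
  qed
qed

section \<open>Both types combined and carried back along the equivalence\<close>

theorem theorem4p1:
  fixes P Q R A B C :: point and m\<^sub>a m\<^sub>b m\<^sub>c :: real
  assumes "triangle P Q R" and "triangle A B C"
    and "transformationally_equivalent P Q R A B C"
    and "m\<^sub>a = slope B C" and "m\<^sub>b = slope A C" and "m\<^sub>c = slope A B"
    and "(minimally_inscribed A B C \<and> completely_inscribed C A B \<and>
          shallow B C \<and> shallow A C \<and> 0 < m\<^sub>a \<and> m\<^sub>a < 1 \<and> -1 < m\<^sub>b \<and> m\<^sub>b < m\<^sub>a \<and>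
          ((\<not> vertical A B \<and> 1 < \<bar>m\<^sub>c\<bar> \<and>
            (m\<^sub>b / m\<^sub>c + 2 * m\<^sub>a - m\<^sub>b - 1 \<ge> 1 / m\<^sub>c \<or>
             1 - m\<^sub>a + 2 * m\<^sub>b - m\<^sub>a / m\<^sub>c \<le> 1 / m\<^sub>c)) \<or>
           (vertical A B \<and> 2 * m\<^sub>a - m\<^sub>b \<ge> 1))) \<or>
         (num_completely_inscribed A B C = 2 \<and> nondiagonal_sides_shallow_and_steep A B C)"
  shows "has_taxicab_apollonius_circle P Q R"
proof -
  obtain f where f: "taxi_transformation f" and fim: "f ` {P, Q, R} = {A, B, C}"
    using assms(3) unfolding transformationally_equivalent_def by blast
  have "has_taxicab_apollonius_circle A B C"
    using assms(7)
  proof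
    assume "num_completely_inscribed A B C = 2 \<and> nondiagonal_sides_shallow_and_steep A B C"
    then show ?thesis using apollonius_of_two_nondiagonal_sides by blast
  next
    assume *: "minimally_inscribed A B C \<and> completely_inscribed C A B \<and>
          shallow B C \<and> shallow A C \<and> 0 < m\<^sub>a \<and> m\<^sub>a < 1 \<and> -1 < m\<^sub>b \<and> m\<^sub>b < m\<^sub>a \<and>
          ((\<not> vertical A B \<and> 1 < \<bar>m\<^sub>c\<bar> \<and>
            (m\<^sub>b / m\<^sub>c + 2 * m\<^sub>a - m\<^sub>b - 1 \<ge> 1 / m\<^sub>c \<or>
             1 - m\<^sub>a + 2 * m\<^sub>b - m\<^sub>a / m\<^sub>c \<le> 1 / m\<^sub>c)) \<or>
           (vertical A B \<and> 2 * m\<^sub>a - m\<^sub>b \<ge> 1))"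
    \<comment> \<open>The inverse slope unites (a) and (b): at \<open>k = 0\<close> the first
      disjunct becomes \<open>2 * m\<^sub>a - m\<^sub>b \<ge> 1\<close>.\<close>
    define k where "k = (if vertical A B then 0 else 1 / m\<^sub>c)"
    have A: "snd A - snd C = m\<^sub>b * (fst A - fst C)" "fst A \<noteq> fst C"
      and B: "snd B - snd C = m\<^sub>a * (fst B - fst C)"
      using * snd_diff_eq_slope[of C A] snd_diff_eq_slope[of C B]
      by (auto simp: assms(4,5) slope_commute vertical_commute shallow_def vertical_def)
    have k: "\<bar>k\<bar> < 1" and AB: "fst B - fst A = k * (snd B - snd A)"
      and cond: "k \<le> m\<^sub>b * k + 2 * m\<^sub>a - m\<^sub>b - 1 \<or> 1 - m\<^sub>a + 2 * m\<^sub>b - m\<^sub>a * k \<le> k"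
      using * snd_diff_eq_slope[of A B]
      by (auto simp: k_def assms(6) vertical_def divide_simps)
    have "A = C + (fst A - fst C, m\<^sub>b * (fst A - fst C))"
      "B = C + (fst B - fst C, m\<^sub>a * (fst B - fst C))"
      using A B by (simp_all add: prod_eq_iff algebra_simps)
    moreover have "(fst B - fst C) - (fst A - fst C) =
        k * (m\<^sub>a * (fst B - fst C) - m\<^sub>b * (fst A - fst C))"
      using A(1) B AB by simp
    ultimately show ?thesis
      using * k cond A(2)
      by (intro apollonius_of_slopes[of m\<^sub>b m\<^sub>a k "fst A - fst C" A C B "fst B - fst C"]) auto
  qed
  \<comment> \<open>Only the vertex sets are known to agree, so the images of \<open>P\<close>,
    \<open>Q\<close>, \<open>R\<close> may be \<open>A\<close>, \<open>B\<close>, \<open>C\<close>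
    in any order.\<close>
  moreover have "{f P, f Q, f R} = {A, B, C}" using fim by simp
  ultimately have "has_taxicab_apollonius_circle (f P) (f Q) (f R)"
    using assms(2) apollonius_permute by metis
  then show ?thesis using taxi_transformation_apollonius[OF f] by blast
qed

end
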